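(* Let $n\ge2$ and let $A=[a_{ij}]\in\mathbb{R}^{n\times n}$ be a nonnegative symmetric matrix with zero diagonal such that the undirected graph $\mathcal{G}(A)$ is connected. For $\alpha\in(0,1)$ consider the system $\dot x_i=u_i$, $i=1,\dots,n$, where $$u_i=\operatorname{sig}\Big(\sum_{j=1}^n a_{ij}(x_j-x_i)\Big)^{\alpha}.$$ Let $0=\lambda_1(L(A))<\lambda_2(L(A))\le\dots\le\lambda_n(L(A))$ be the eigenvalues of the graph Laplacian $L(A)$ in increasing order. Given $0<\alpha_*<\alpha^*<1$, let $$\epsilon^*=\frac{1}{2\lambda_2(L(A))}\,n^{\frac{1-\alpha_*}{\alpha^*-\alpha_*}},\qquad \epsilon_*=\frac{1}{2\lambda_n(L(A))}.$$ Let $V_5=\frac14\sum_{i,j=1}^n a_{ij}(x_j-x_i)^2$, and let $\left.\frac{dV_5}{dt}\right|_{\alpha}$ denote the time derivative of $V_5$ along the system with parameter $\alpha$ at the state $x\in\mathbb{R}^n$. Then, at every state $x$: if $V_5\ge\epsilon^*$, then $$\left.\frac{dV_5}{dt}\right|_{\alpha=\alpha^*}\le\left.\frac{dV_5}{dt}\right|_{\alpha=\alpha_*},$$ and if $V_5\le\epsilon_*$, then $$\left.\frac{dV_5}{dt}\right|_{\alpha=\alpha_*}\le\left.\frac{dV_5}{dt}\right|_{\alpha=\alpha^*}.$$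
   Context: For $r\in\mathbb{R}$ and $\alpha>0$, $\operatorname{sig}(r)^\alpha:=\operatorname{sign}(r)|r|^\alpha$, with $\operatorname{sign}(0)=0$. The graph $\mathcal{G}(A)$ has vertices $v_1,\dots,v_n$ and an edge $(v_i,v_j)$ if and only if $a_{ji}>0$; it is undirected because $A^T=A$, and connected means that any two distinct vertices are joined by a path. The graph Laplacian $L(A)=[l_{ij}]$ is given by $l_{ii}=\sum_{k\ne i}a_{ik}$ and $l_{ij}=-a_{ij}$ for $j\ne i$. The time derivative along the system at state $x$ is $\left.\frac{dV_5}{dt}\right|_{\alpha}=\sum_{i=1}^n\frac{\partial V_5}{\partial x_i}(x)\,u_i(x)$, with $u_i$ computed using the exponent $\alpha$; both derivatives in each inequality are evaluated at the same state. *)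

theory Defs
  imports
    "HOL-Analysis.Derivative"
    "Jordan_Normal_Form.Char_Poly"
    "Graph_Theory.Digraph_Component"
begin

definition sig :: "real \<Rightarrow> real \<Rightarrow> real" where
  "sig r \<alpha> = sgn r * \<bar>r\<bar> powr \<alpha>"

(* The vertex v_i of the usual 1-based numbering is i - 1, in line with the 0-based indices of
   matrices and vectors.  The arc (i, j) is weighted by the transposed entry (j, i).  Only
   symmetric A are of interest, and then Digraph_Component.connected, which passes to the
   underlying symmetric graph, is connectedness of the graph itself. *)
definition weight_graph :: "real mat \<Rightarrow> nat pair_pre_digraph" where
  "weight_graph A = \<lparr>pverts = {0..<dim_row A},
     parcs = {(i, j). i < dim_row A \<and> j < dim_row A \<and> A $$ (j, i) > 0}\<rparr>"

definition laplacian :: "real mat \<Rightarrow> real mat" where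
  "laplacian A = mat (dim_row A) (dim_row A)
     (\<lambda>(i, j). if i = j then (\<Sum>k\<in>{0..<dim_row A} - {i}. A $$ (i, k)) else - (A $$ (i, j)))"

(* kth_eigenvalue M k is the k-th smallest real eigenvalue, counted from k = 1 and with
   multiplicity as a root of the characteristic polynomial.  A real symmetric matrix has as
   many of them as its dimension; for other matrices or k = 0 the value is meaningless. *)
definition kth_eigenvalue :: "real mat \<Rightarrow> nat \<Rightarrow> real" where
  "kth_eigenvalue M k = sorted_list_of_multiset (proots (char_poly M)) ! (k - 1)"

definition protocol :: "real mat \<Rightarrow> real \<Rightarrow> real vec \<Rightarrow> nat \<Rightarrow> real" where
  "protocol A \<alpha> x i = sig (\<Sum>j = 0..<dim_row A. A $$ (i, j) * (x $ j - x $ i)) \<alpha>"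

definition V5 :: "real mat \<Rightarrow> real vec \<Rightarrow> real" where
  "V5 A x = 1 / 4 * (\<Sum>i = 0..<dim_row A. \<Sum>j = 0..<dim_row A. A $$ (i, j) * (x $ j - x $ i)\<^sup>2)"

definition partial_deriv :: "(real vec \<Rightarrow> real) \<Rightarrow> nat \<Rightarrow> real vec \<Rightarrow> real" where
  "partial_deriv f i x = deriv (\<lambda>t. f (x + t \<cdot>\<^sub>v unit_vec (dim_vec x) i)) 0"

definition dV5_dt :: "real mat \<Rightarrow> real \<Rightarrow> real vec \<Rightarrow> real" where
  "dV5_dt A \<alpha> x = (\<Sum>i = 0..<dim_row A. partial_deriv (V5 A) i x * protocol A \<alpha> x i)"

end

theory Submission
  imports Defs "Jordan_Normal_Form.Schur_Decomposition"
begin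

text \<open>
  Write \<open>y = L(A) x\<close>.  The energy \<open>V\<^sub>5\<close> is half the quadratic form of the Laplacian, so its
  gradient is \<open>y\<close>, while the control of vertex \<open>i\<close> is \<open>sig(- y\<^sub>i)\<^sup>\<alpha>\<close>.  Hence the energy decays at
  the rate \<open>\<Sum>\<^sub>i \<bar>y\<^sub>i\<bar>\<^sup>1\<^sup>+\<^sup>\<alpha>\<close> (\<open>dV5_dt_eq_neg_sum_powr\<close>), and the theorem compares two power
  sums of the same vector, with exponents \<open>p = 1 + \<alpha>\<^sub>1\<close> and \<open>q = 1 + \<alpha>\<^sub>2\<close> below 2.

  If \<open>\<Sum>\<^sub>i y\<^sub>i\<^sup>2 \<le> 1\<close>, every \<open>\<bar>y\<^sub>i\<bar>\<close> is at most 1 and the smaller exponent gives the larger sum.  If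
  \<open>\<Sum>\<^sub>i y\<^sub>i\<^sup>2\<close> is large, the larger exponent wins although single entries may be small: by Young's
  inequality \<open>\<bar>y\<^sub>i\<bar>\<^sup>p\<close> is at most the weighted mean of \<open>\<bar>y\<^sub>i\<bar>\<^sup>q\<close> and 1 with weight \<open>p / q\<close> on the
  first, so it suffices that the \<open>\<bar>y\<^sub>i\<bar>\<^sup>q\<close> have average at least 1.  This average condition follows
  from the bound on \<open>\<Sum>\<^sub>i y\<^sub>i\<^sup>2\<close> because \<open>q \<le> 2\<close>
  (\<open>sum_powr_mono_if_sum_squares_large\<close>).

  The spectrum of the Laplacian converts between \<open>\<Sum>\<^sub>i y\<^sub>i\<^sup>2\<close> and the energy.  In an orthonormal
  eigenbasis the squared norm of \<open>L x\<close> weighs the squared coordinates of \<open>x\<close> with the squared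
  eigenvalues and the form \<open>x \<bullet> L x = 2 V\<^sub>5\<close> weighs them with the eigenvalues.  Therefore
  \<open>2 \<lambda>\<^sub>2 V\<^sub>5 \<le> \<Sum>\<^sub>i y\<^sub>i\<^sup>2 \<le> 2 \<lambda>\<^sub>n V\<^sub>5\<close>; the left inequality needs that an eigenvalue is either 0 or at
  least \<open>\<lambda>\<^sub>2\<close>.  Connectedness makes the kernel of the Laplacian consist of the constant vectors, so 0
  is a simple eigenvalue and \<open>\<lambda>\<^sub>2 > 0\<close>.  The two thresholds for \<open>V\<^sub>5\<close> are what these inequalities
  require.  The eigenbasis comes from the spectral theorem for real symmetric matrices, proved with
  the eigenvalues in a prescribed order so that sorting them yields \<open>kth_eigenvalue\<close>.
\<close>

section \<open>Real symmetric matrices have an orthonormal eigenbasis\<close>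

lemma symmetric_mat_scalar_prod:
  fixes M :: "'a :: comm_semiring_0 mat"
  assumes M: "M \<in> carrier_mat n n" and sym: "M\<^sup>T = M"
    and v: "v \<in> carrier_vec n" and w: "w \<in> carrier_vec n"
  shows "(M *\<^sub>v v) \<bullet> w = v \<bullet> (M *\<^sub>v w)"
  using transpose_vec_mult_scalar[OF M w v] sym v w M
  by (metis comm_scalar_prod mult_mat_vec_carrier)

text \<open>
  For a complex eigenvector \<open>z\<close> to \<open>k\<close>, moving the matrix across the Hermitian product of \<open>z\<close>
  with itself turns the factor \<open>k\<close> into its conjugate.
\<close>

lemma real_symmetric_eigenvalue_real:
  fixes M :: "real mat"
  assumes M: "M \<in> carrier_mat n n" and sym: "M\<^sup>T = M"
    and ev: "eigenvalue (map_mat complex_of_real M) k"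
  shows "k \<in> \<real>"
proof -
  let ?C = "map_mat complex_of_real M"
  have C: "?C \<in> carrier_mat n n" using M by simp
  have symC: "?C\<^sup>T = ?C" using sym by (metis map_mat_transpose)
  obtain z where z: "z \<in> carrier_vec n" "z \<noteq> 0\<^sub>v n" and Cz: "?C *\<^sub>v z = k \<cdot>\<^sub>v z"
    using ev M unfolding eigenvalue_def eigenvector_def by auto
  have cz: "conjugate z \<in> carrier_vec n" using z by simp
  have "?C *\<^sub>v conjugate z = conjugate (?C *\<^sub>v z)"
  proof (rule eq_vecI)
    fix i assume "i < dim_vec (conjugate (?C *\<^sub>v z))"
    then have i: "i < n" using M by simp
    have r: "conjugate (row ?C i) = row ?C i"
      using i M by (intro eq_vecI) auto
    have "conjugate (row ?C i \<bullet> z) = conjugate (row ?C i) \<bullet> conjugate z"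
      by (rule conjugate_sprod_vec[of _ n]) (use z C i in auto)
    then show "(?C *\<^sub>v conjugate z) $ i = conjugate (?C *\<^sub>v z) $ i"
      using i M r by simp
  qed (use M in simp)
  then have Ccz: "?C *\<^sub>v conjugate z = cnj k \<cdot>\<^sub>v conjugate z"
    by (simp add: Cz conjugate_smult_vec)
  have "k * (z \<bullet>c z) = cnj k * (z \<bullet>c z)"
    using symmetric_mat_scalar_prod[OF C symC z(1) cz] z(1) cz by (simp add: Cz Ccz)
  moreover have "z \<bullet>c z \<noteq> 0" using z by simp
  ultimately have "cnj k = k" by simp
  then show ?thesis by (simp add: Reals_cnj_iff)
qed

text \<open>
  Over the complex numbers every characteristic polynomial splits; here all its roots are real, so
  the factorization descends to the reals.
\<close>

lemma real_symmetric_char_poly_splits: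
  fixes M :: "real mat"
  assumes M: "M \<in> carrier_mat n n" and sym: "M\<^sup>T = M"
  obtains es where "sorted es" "length es = n" "char_poly M = (\<Prod>e\<leftarrow>es. [:- e, 1:])"
proof -
  let ?C = "map_mat complex_of_real M"
  have C: "?C \<in> carrier_mat n n" using M by simp
  interpret h: map_poly_inj_comm_ring_hom "of_real :: real \<Rightarrow> complex" ..
  obtain as where as: "char_poly ?C = (\<Prod>a\<leftarrow>as. [:- a, 1:])" "length as = n"
    using char_poly_factorized[OF C] by auto
  have real: "complex_of_real (Re a) = a" if "a \<in> set as" for a
  proof -
    have "poly (char_poly ?C) a = 0"
      using that unfolding as poly_prod_list by (auto simp: prod_list_zero_iff)
    then have "eigenvalue ?C a" using eigenvalue_root_char_poly[OF C] by simp
    then show ?thesis using real_symmetric_eigenvalue_real[OF M sym] by simp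
  qed
  have "map_poly complex_of_real (char_poly M) = char_poly ?C"
    by (rule of_real_hom.char_poly_hom[OF M, symmetric])
  also have "\<dots> = (\<Prod>a\<leftarrow>as. map_poly complex_of_real [:- Re a, 1:])"
    unfolding as using real by (intro arg_cong[of _ _ prod_list] map_cong) auto
  also have "\<dots> = map_poly complex_of_real (\<Prod>a\<leftarrow>as. [:- Re a, 1:])"
    by (simp add: h.hom_prod_list o_def)
  finally have "char_poly M = (\<Prod>e\<leftarrow>map Re as. [:- e, 1:])"
    by (simp add: o_def)
  also have "\<dots> = (\<Prod>e\<leftarrow>sort (map Re as). [:- e, 1:])"
    by (simp add: multiset.map_comp flip: prod_mset_prod_list)
  finally show ?thesis using that[of "sort (map Re as)"] as by simp
qed

lemma sorted_list_of_proots_linear_factors: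
  assumes "sorted es"
  shows "sorted_list_of_multiset (proots (\<Prod>e\<leftarrow>es. [:- e, 1 :: real:])) = es"
proof -
  have "proots (\<Prod>e\<leftarrow>es. [:- e, 1:]) = mset es"
  proof (induction es)
    case (Cons e es)
    have "(\<Prod>e\<leftarrow>es. [:- e, 1 :: real:]) \<noteq> 0" by (auto simp: prod_list_zero_iff)
    then show ?case
      using Cons.IH by (simp add: proots_mult del: mult_pCons_left)
  qed simp
  then show ?thesis using assms by (simp add: sort_key_id_if_sorted)
qed

text \<open>
  Complete \<open>v\<close> to a basis, apply Gram-Schmidt, which keeps the first vector, and normalize.
\<close>

lemma orthogonal_mat_with_first_column:
  fixes v :: "real vec"
  assumes v: "v \<in> carrier_vec n" "v \<noteq> 0\<^sub>v n"
  obtains W where "W \<in> carrier_mat n n" "W\<^sup>T * W = 1\<^sub>m n" "\<exists>c. col W 0 = c \<cdot>\<^sub>v v"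
proof -
  interpret cof_vec_space n "TYPE(real)" .
  have n: "n \<noteq> 0" using v by (intro notI) auto
  define b where "b = basis_completion v"
  define ws where "ws = gram_schmidt n b"
  note bc = basis_completion[OF v, folded b_def]
  obtain vs where bv: "b = v # vs" by (simp add: b_def basis_completion_def Let_def)
  note gs = gram_schmidt_result[OF bc(2) bc(4) bc(5) ws_def]
  have ws: "set ws \<subseteq> carrier_vec n" "corthogonal ws" "length ws = n"
    using gs bc by auto
  have hd: "ws ! 0 = v"
    using gram_schmidt_hd[OF v(1), of vs, folded bv] ws(3) n
    by (metis hd_conv_nth list.size(3) ws_def)
  have conj: "conjugate w = w" for w :: "real vec" by (intro eq_vecI) auto
  have orth: "ws ! i \<bullet> ws ! j = 0 \<longleftrightarrow> i \<noteq> j" if "i < n" "j < n" for i j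
    using corthogonalD[OF ws(2), of i j] that ws(3) by (simp add: conj)
  define r where "r i = 1 / sqrt (ws ! i \<bullet> ws ! i)" for i
  define W where "W = mat_of_cols n (map (\<lambda>i. r i \<cdot>\<^sub>v ws ! i) [0..<n])"
  have wsi: "ws ! i \<in> carrier_vec n" if "i < n" for i
    using ws(1,3) that nth_mem by blast
  have W: "W \<in> carrier_mat n n" unfolding W_def by (rule carrier_matI) simp_all
  have colW: "col W i = r i \<cdot>\<^sub>v ws ! i" if "i < n" for i
    using that wsi[OF that] by (simp add: W_def)
  have "W\<^sup>T * W = 1\<^sub>m n"
  proof (rule eq_matI)
    fix i j assume "i < dim_row (1\<^sub>m n)" "j < dim_col (1\<^sub>m n)"
    then have ij: "i < n" "j < n" by auto
    have pos: "ws ! i \<bullet> ws ! i > 0"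
      using orth[OF ij(1,1)] conjugate_square_ge_0_vec[of "ws ! i"] by (simp add: conj)
    have "(W\<^sup>T * W) $$ (i, j) = (r i \<cdot>\<^sub>v ws ! i) \<bullet> (r j \<cdot>\<^sub>v ws ! j)"
      using ij W colW by simp
    also have "\<dots> = r i * (r j * (ws ! i \<bullet> ws ! j))"
      using wsi[OF ij(1)] wsi[OF ij(2)] by simp
    finally have "(W\<^sup>T * W) $$ (i, j) = r i * (r j * (ws ! i \<bullet> ws ! j))" .
    then show "(W\<^sup>T * W) $$ (i, j) = 1\<^sub>m n $$ (i, j)"
      using ij orth[OF ij] pos by (auto simp: r_def)
  qed (use W in auto)
  moreover have "\<exists>c. col W 0 = c \<cdot>\<^sub>v v" using colW[of 0] n hd by auto
  ultimately show ?thesis using that W by blast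
qed

definition diag_of_list :: "'a :: zero list \<Rightarrow> 'a mat" where
  "diag_of_list es = mat (length es) (length es) (\<lambda>(i, j). if i = j then es ! i else 0)"

text \<open>
  The spectral theorem, by induction on the list of eigenvalues.  In an orthonormal basis that starts
  with an eigenvector to \<open>e\<close>, the first column of the matrix is \<open>e\<close> times the first unit vector.  By
  symmetry the same holds for the first row, so the rest of the matrix is a symmetric block with one
  eigenvalue less.  The diagonal inherits the order of the list, which may be chosen freely.
\<close>

lemma real_symmetric_orthogonal_diagonalization:
  fixes M :: "real mat"
  assumes "M \<in> carrier_mat n n" and "M\<^sup>T = M"
    and "char_poly M = (\<Prod>e\<leftarrow>es. [:- e, 1:])"
  shows "\<exists>U \<in> carrier_mat n n. U\<^sup>T * U = 1\<^sub>m n \<and> U\<^sup>T * M * U = diag_of_list es"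
  using assms
proof (induction es arbitrary: n M)
  case Nil
  then have "n = 0" using degree_monic_char_poly[of M n] by simp
  then show ?case using Nil by (intro bexI[of _ "1\<^sub>m 0"]) (auto simp: diag_of_list_def intro: eq_matI)
next
  case (Cons e es)
  note M = Cons.prems(1) and sym = Cons.prems(2) and cp = Cons.prems(3)
  have ev: "eigenvalue M e"
    unfolding eigenvalue_root_char_poly[OF M] cp by simp
  then obtain v where v: "v \<in> carrier_vec n" "v \<noteq> 0\<^sub>v n" "M *\<^sub>v v = e \<cdot>\<^sub>v v"
    using M unfolding eigenvalue_def eigenvector_def by auto
  obtain m where n: "n = Suc m" using v by (cases n) auto
  obtain W c where W: "W \<in> carrier_mat n n" and WW: "W\<^sup>T * W = 1\<^sub>m n" and c: "col W 0 = c \<cdot>\<^sub>v v"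
    using orthogonal_mat_with_first_column[OF v(1,2)] by metis
  have WT: "W\<^sup>T \<in> carrier_mat n n" using W by simp
  have WW': "W * W\<^sup>T = 1\<^sub>m n" by (rule mat_mult_left_right_inverse[OF WT W WW])
  define M' where "M' = W\<^sup>T * M * W"
  have M': "M' \<in> carrier_mat n n" using W M by (simp add: M'_def)
  have sym': "M'\<^sup>T = M'"
    using W M by (simp add: M'_def transpose_mult[of _ n n _ n] sym assoc_mult_mat[of _ n n _ n _ n])
  have first: "M' $$ (i, 0) = (if i = 0 then e else 0)" if i: "i < n" for i
  proof -
    have "M *\<^sub>v col W 0 = e \<cdot>\<^sub>v col W 0"
      using v M by (simp add: c mult_mat_vec smult_smult_assoc mult.commute)
    then have "col (M * W) 0 = e \<cdot>\<^sub>v col W 0" using col_mult2[OF M W, of 0] n by simp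
    then have "M' $$ (i, 0) = e * (W\<^sup>T * W) $$ (i, 0)"
      using i W M n by (simp add: M'_def assoc_mult_mat[of _ n n _ n _ n])
    then show ?thesis using i by (simp add: WW)
  qed
  have first': "M' $$ (0, i) = (if i = 0 then e else 0)" if i: "i < n" for i
    using first[OF i] sym' M' n i by (metis carrier_matD index_transpose_mat(1) zero_less_Suc)
  define M3 where "M3 = mat m m (\<lambda>(i, j). M' $$ (Suc i, Suc j))"
  let ?E = "mat 1 1 (\<lambda>_. e)"
  have M3: "M3 \<in> carrier_mat m m" by (simp add: M3_def)
  have block: "M' = four_block_mat ?E (0\<^sub>m 1 m) (0\<^sub>m m 1) M3"
    using M' first first' n by (intro eq_matI) (auto simp: M3_def)
  have sym3: "M3\<^sup>T = M3"
  proof (rule eq_matI)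
    fix i j assume "i < dim_row M3" "j < dim_col M3"
    then show "M3\<^sup>T $$ (i, j) = M3 $$ (i, j)"
      using sym' M' n by (simp add: M3_def) (metis Suc_mono carrier_matD index_transpose_mat(1))
  qed (simp_all add: M3_def)
  have "similar_mat M' M"
    unfolding similar_mat_def
    by (intro exI, rule similar_mat_witI[OF WW WW' M'_def M' M]) (use W in auto)
  then have "[:- e, 1:] * (\<Prod>e\<leftarrow>es. [:- e, 1:]) = char_poly M'"
    using cp by (simp add: char_poly_similar)
  also have "\<dots> = char_poly ?E * char_poly M3"
    unfolding block by (rule char_poly_four_block_zeros_col) (use M3 in auto)
  also have "char_poly ?E = [:- e, 1:]"
    by (simp add: char_poly_defs det_def sign_def)
  finally have cp3: "char_poly M3 = (\<Prod>e\<leftarrow>es. [:- e, 1:])"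
    by (metis mult_cancel_left pCons_eq_0_iff zero_neq_one)
  obtain U where U: "U \<in> carrier_mat m m" and UU: "U\<^sup>T * U = 1\<^sub>m m"
    and UMU: "U\<^sup>T * M3 * U = diag_of_list es"
    using Cons.IH[OF M3 sym3 cp3] by auto
  define F where "F = four_block_mat (1\<^sub>m 1) (0\<^sub>m 1 m) (0\<^sub>m m 1) U"
  have F: "F \<in> carrier_mat n n" using four_block_carrier_mat[of "1\<^sub>m 1" 1 1 U m m] U n by (simp add: F_def)
  have FT: "F\<^sup>T = four_block_mat (1\<^sub>m 1) (0\<^sub>m 1 m) (0\<^sub>m m 1) U\<^sup>T"
    unfolding F_def using U by (subst transpose_four_block_mat) auto
  have FF: "F\<^sup>T * F = 1\<^sub>m n"
    unfolding FT unfolding F_def using U UU n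
    by (subst mult_four_block_mat[of _ 1 1 _ m _ m _ _ 1 _ m]) auto
  have "F\<^sup>T * M' * F = four_block_mat ?E (0\<^sub>m 1 m) (0\<^sub>m m 1) (U\<^sup>T * M3 * U)"
    unfolding FT block unfolding F_def using U M3
    by (simp add: mult_four_block_mat[of _ 1 1 _ m _ m _ _ 1 _ m])
  also have "\<dots> = diag_of_list (e # es)"
  proof -
    have "length es = m" using arg_cong[OF UMU, of dim_row] U by (simp add: diag_of_list_def)
    then show ?thesis unfolding UMU
      by (intro eq_matI) (auto simp: diag_of_list_def nth_Cons')
  qed
  finally have FMF: "F\<^sup>T * M' * F = diag_of_list (e # es)" .
  have "(W * F)\<^sup>T * (W * F) = F\<^sup>T * (W\<^sup>T * W) * F"
    using W F by (simp add: transpose_mult[of _ n n _ n] assoc_mult_mat[of _ n n _ n _ n])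
  then have "(W * F)\<^sup>T * (W * F) = 1\<^sub>m n" using F by (simp add: WW FF)
  moreover have "(W * F)\<^sup>T * M * (W * F) = F\<^sup>T * M' * F"
    using W F M by (simp add: M'_def transpose_mult[of _ n n _ n] assoc_mult_mat[of _ n n _ n _ n])
  ultimately show ?case using W F FMF by (intro bexI[of _ "W * F"]) auto
qed

text \<open>
  What the diagonalization says about vectors.  The coordinates of \<open>x\<close> in the eigenbasis are the
  entries of \<open>U\<^sup>T x\<close>; there \<open>M\<close> acts by multiplication with the eigenvalues, and \<open>U\<close> preserves scalar
  products.
\<close>

lemma orthogonal_eigenbasis:
  fixes M :: "real mat"
  assumes M: "M \<in> carrier_mat n n" and U: "U \<in> carrier_mat n n" and UU: "U\<^sup>T * U = 1\<^sub>m n"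
    and UMU: "U\<^sup>T * M * U = diag_of_list es"
  shows "\<And>i j. i < n \<Longrightarrow> j < n \<Longrightarrow> col U i \<bullet> col U j = (if i = j then 1 else 0)"
    and "\<And>i. i < n \<Longrightarrow> M *\<^sub>v col U i = es ! i \<cdot>\<^sub>v col U i"
    and "\<And>x. x \<in> carrier_vec n \<Longrightarrow> x \<bullet> (M *\<^sub>v x) = (\<Sum>i<n. es ! i * ((U\<^sup>T *\<^sub>v x) $ i)\<^sup>2)"
    and "\<And>x. x \<in> carrier_vec n \<Longrightarrow>
           (M *\<^sub>v x) \<bullet> (M *\<^sub>v x) = (\<Sum>i<n. (es ! i)\<^sup>2 * ((U\<^sup>T *\<^sub>v x) $ i)\<^sup>2)"
proof -
  have UT: "U\<^sup>T \<in> carrier_mat n n" using U by simp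
  have UU': "U * U\<^sup>T = 1\<^sub>m n" by (rule mat_mult_left_right_inverse[OF UT U UU])
  have len: "length es = n"
    using arg_cong[OF UMU, of dim_row] U by (simp add: diag_of_list_def)
  let ?D = "diag_of_list es"
  have D: "?D \<in> carrier_mat n n" using len by (simp add: diag_of_list_def)
  show "col U i \<bullet> col U j = (if i = j then 1 else 0)" if "i < n" "j < n" for i j
    using that U arg_cong[OF UU, of "\<lambda>X. X $$ (i, j)"] by simp
  have "U * ?D = (U * U\<^sup>T) * (M * U)"
    unfolding UMU[symmetric] using U M by (simp add: assoc_mult_mat[of _ n n _ n _ n])
  then have MU: "M * U = U * ?D" using M U by (simp add: UU')
  show "M *\<^sub>v col U i = es ! i \<cdot>\<^sub>v col U i" if i: "i < n" for i
  proof -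
    have "col ?D i = es ! i \<cdot>\<^sub>v unit_vec n i"
      using i len by (intro eq_vecI) (auto simp: diag_of_list_def)
    moreover have "U *\<^sub>v unit_vec n i = col U i"
      using i U by (intro eq_vecI) auto
    ultimately have "U *\<^sub>v col ?D i = es ! i \<cdot>\<^sub>v col U i"
      using mult_mat_vec[OF U, of "unit_vec n i" "es ! i"] by simp
    then show ?thesis
      using MU col_mult2[OF M U i] col_mult2[OF U D i] by simp
  qed
  fix x :: "real vec" assume x: "x \<in> carrier_vec n"
  define c where "c = U\<^sup>T *\<^sub>v x"
  have c: "c \<in> carrier_vec n" using U by (simp add: c_def carrier_vecI)
  have xc: "x = U *\<^sub>v c"
    using x U UT by (simp add: c_def UU' flip: assoc_mult_mat_vec[OF U UT x])
  have Dc: "?D *\<^sub>v c \<in> carrier_vec n" using D c by simp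
  have Mx: "M *\<^sub>v x = U *\<^sub>v (?D *\<^sub>v c)"
    using assoc_mult_mat_vec[OF M U c] assoc_mult_mat_vec[OF U D c] by (simp add: xc MU)
  have iso: "(U *\<^sub>v v) \<bullet> (U *\<^sub>v w) = (\<Sum>i<n. v $ i * w $ i)"
    if v: "v \<in> carrier_vec n" and w: "w \<in> carrier_vec n" for v w
  proof -
    have "(U *\<^sub>v v) \<bullet> (U *\<^sub>v w) = v \<bullet> (U\<^sup>T *\<^sub>v (U *\<^sub>v w))"
      using transpose_vec_mult_scalar[OF UT, of "U *\<^sub>v w" v] U v w by simp
    also have "U\<^sup>T *\<^sub>v (U *\<^sub>v w) = w"
      using w by (simp add: UU flip: assoc_mult_mat_vec[OF UT U w])
    finally show ?thesis using w by (simp add: scalar_prod_def lessThan_atLeast0)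
  qed
  have Dci: "(?D *\<^sub>v c) $ i = es ! i * c $ i" if i: "i < n" for i
  proof -
    have "(?D *\<^sub>v c) $ i = (\<Sum>j = 0..<n. (if i = j then es ! i else 0) * c $ j)"
      using i c len by (simp add: diag_of_list_def scalar_prod_def)
    also have "\<dots> = (\<Sum>j = 0..<n. if i = j then es ! i * c $ i else 0)"
      by (intro sum.cong) auto
    finally show ?thesis using i by simp
  qed
  show "x \<bullet> (M *\<^sub>v x) = (\<Sum>i<n. es ! i * ((U\<^sup>T *\<^sub>v x) $ i)\<^sup>2)"
    unfolding c_def[symmetric] Mx
    by (subst xc, subst iso[OF c Dc], intro sum.cong) (auto simp: Dci power2_eq_square)
  show "(M *\<^sub>v x) \<bullet> (M *\<^sub>v x) = (\<Sum>i<n. (es ! i)\<^sup>2 * ((U\<^sup>T *\<^sub>v x) $ i)\<^sup>2)"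
    unfolding c_def[symmetric] Mx
    by (subst iso[OF Dc Dc], intro sum.cong) (auto simp: Dci power2_eq_square)
qed

lemma sorted_orthogonal_eigenbasis:
  fixes M :: "real mat"
  assumes M: "M \<in> carrier_mat n n" and sym: "M\<^sup>T = M"
  obtains es U where "sorted es" "length es = n"
    "\<forall>k. kth_eigenvalue M k = es ! (k - 1)" "\<forall>e. e \<in> set es \<longleftrightarrow> eigenvalue M e"
    "U \<in> carrier_mat n n" "U\<^sup>T * U = 1\<^sub>m n" "U\<^sup>T * M * U = diag_of_list es"
proof -
  obtain es where es: "sorted es" "length es = n" "char_poly M = (\<Prod>e\<leftarrow>es. [:- e, 1:])"
    using real_symmetric_char_poly_splits[OF M sym] .
  have eig: "\<forall>e. e \<in> set es \<longleftrightarrow> eigenvalue M e"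
    unfolding eigenvalue_root_char_poly[OF M] es(3) poly_prod_list
    by (auto simp: prod_list_zero_iff)
  have kth: "\<forall>k. kth_eigenvalue M k = es ! (k - 1)"
    by (simp add: kth_eigenvalue_def es sorted_list_of_proots_linear_factors)
  from real_symmetric_orthogonal_diagonalization[OF M sym es(3)]
  show ?thesis by (elim bexE conjE) (rule that[OF es(1,2) kth eig])
qed

section \<open>Extremal eigenvalues of positive semidefinite matrices\<close>

lemma psd_eigenvalues_nonneg:
  fixes M :: "real mat"
  assumes psd: "\<forall>v\<in>carrier_vec n. 0 \<le> v \<bullet> (M *\<^sub>v v)"
    and M: "M \<in> carrier_mat n n" and ev: "eigenvalue M e"
  shows "e \<ge> 0"
proof -
  obtain v where v: "v \<in> carrier_vec n" "v \<noteq> 0\<^sub>v n" "M *\<^sub>v v = e \<cdot>\<^sub>v v"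
    using ev M unfolding eigenvalue_def eigenvector_def by auto
  have "conjugate v = v" by (intro eq_vecI) auto
  then have "v \<bullet> v > 0" using v conjugate_square_greater_0_vec[OF v(1)] by simp
  moreover have "0 \<le> e * (v \<bullet> v)" using bspec[OF psd v(1)] v by simp
  ultimately show ?thesis by (simp add: zero_le_mult_iff)
qed

text \<open>
  In eigencoordinates this is the sum of the inequalities \<open>e\<^sub>i\<^sup>2 \<le> e\<^sub>n e\<^sub>i\<close>, weighted with the squared
  coordinates; they hold because \<open>0 \<le> e\<^sub>i \<le> e\<^sub>n\<close>.
\<close>

lemma psd_norm_le_largest_eigenvalue:
  fixes M :: "real mat"
  assumes M: "M \<in> carrier_mat n n" and sym: "M\<^sup>T = M"
    and psd: "\<forall>v\<in>carrier_vec n. 0 \<le> v \<bullet> (M *\<^sub>v v)"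
    and x: "x \<in> carrier_vec n"
  shows "(M *\<^sub>v x) \<bullet> (M *\<^sub>v x) \<le> kth_eigenvalue M n * (x \<bullet> (M *\<^sub>v x))"
proof -
  obtain es U where es: "sorted es" "length es = n" "\<forall>k. kth_eigenvalue M k = es ! (k - 1)"
      "\<forall>e. e \<in> set es \<longleftrightarrow> eigenvalue M e"
    and U: "U \<in> carrier_mat n n" "U\<^sup>T * U = 1\<^sub>m n" "U\<^sup>T * M * U = diag_of_list es"
    using sorted_orthogonal_eigenbasis[OF M sym] .
  have "(es ! i)\<^sup>2 \<le> kth_eigenvalue M n * es ! i" if i: "i < n" for i
  proof -
    have "eigenvalue M (es ! i)" using es(2,4) i nth_mem by blast
    then have "0 \<le> es ! i" by (rule psd_eigenvalues_nonneg[OF psd M])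
    moreover have "es ! i \<le> es ! (n - 1)" using es(1,2) i by (intro sorted_nth_mono) auto
    ultimately show ?thesis by (simp add: es(3) power2_eq_square mult_right_mono)
  qed
  then show ?thesis
    unfolding orthogonal_eigenbasis(3,4)[OF M U x] sum_distrib_left
    by (intro sum_mono) (auto intro!: mult_right_mono simp flip: mult.assoc)
qed

text \<open>
  The spectral gap.  A nonzero kernel makes the smallest eigenvalue 0.  If the second one vanished as
  well, two orthonormal eigenvectors would both be multiples of \<open>u\<close>, which is impossible.  The
  inequality sums \<open>e\<^sub>2 e\<^sub>i \<le> e\<^sub>i\<^sup>2\<close>, true for the first eigenvalue because it is 0 and for all later ones
  because they are at least \<open>e\<^sub>2\<close>.
\<close>

lemma psd_simple_kernel_second_eigenvalue:
  fixes M :: "real mat"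
  assumes n: "n \<ge> 2" and M: "M \<in> carrier_mat n n" and sym: "M\<^sup>T = M"
    and psd: "\<forall>v\<in>carrier_vec n. 0 \<le> v \<bullet> (M *\<^sub>v v)"
    and u: "u \<in> carrier_vec n" "u \<noteq> 0\<^sub>v n" "M *\<^sub>v u = 0\<^sub>v n"
    and ker: "\<forall>v\<in>carrier_vec n. M *\<^sub>v v = 0\<^sub>v n \<longrightarrow> (\<exists>c. v = c \<cdot>\<^sub>v u)"
  shows "kth_eigenvalue M 2 > 0"
    and "x \<in> carrier_vec n \<Longrightarrow> kth_eigenvalue M 2 * (x \<bullet> (M *\<^sub>v x)) \<le> (M *\<^sub>v x) \<bullet> (M *\<^sub>v x)"
proof -
  obtain es U where es: "sorted es" "length es = n" "\<forall>k. kth_eigenvalue M k = es ! (k - 1)"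
      "\<forall>e. e \<in> set es \<longleftrightarrow> eigenvalue M e"
    and U: "U \<in> carrier_mat n n" "U\<^sup>T * U = 1\<^sub>m n" "U\<^sup>T * M * U = diag_of_list es"
    using sorted_orthogonal_eigenbasis[OF M sym] .
  have nonneg: "0 \<le> es ! i" if "i < n" for i
  proof -
    have "eigenvalue M (es ! i)" using es(2,4) that nth_mem by blast
    then show ?thesis by (rule psd_eigenvalues_nonneg[OF psd M])
  qed
  have "eigenvalue M 0"
    using u M unfolding eigenvalue_def eigenvector_def by (intro exI[of _ u]) auto
  then obtain i where "i < n" "es ! i = 0" using es(2,4) by (metis in_set_conv_nth)
  then have es0: "es ! 0 = 0"
    using sorted_nth_mono[OF es(1), of 0 i] nonneg[of 0] es(2) n by simp
  have "es ! 1 \<noteq> 0"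
  proof
    assume es1: "es ! 1 = 0"
    have 01: "0 < n" "1 < n" using n by auto
    have "\<exists>c. col U j = c \<cdot>\<^sub>v u" if "j < n" "es ! j = 0" for j
    proof -
      have "col U j \<in> carrier_vec n" using U that by simp
      moreover have "M *\<^sub>v col U j = 0\<^sub>v n"
        using orthogonal_eigenbasis(2)[OF M U that(1)] that(2) U by (intro eq_vecI) auto
      ultimately show ?thesis using ker by blast
    qed
    then obtain a b where ab: "col U 0 = a \<cdot>\<^sub>v u" "col U 1 = b \<cdot>\<^sub>v u"
      using es0 es1 01 by blast
    note orth = orthogonal_eigenbasis(1)[OF M U]
    have smult: "(s \<cdot>\<^sub>v u) \<bullet> (t \<cdot>\<^sub>v u) = s * (t * (u \<bullet> u))" for s t
      using u(1) by (simp add: smult_scalar_prod_distrib[of _ n] scalar_prod_smult_distrib[of _ n])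
    have "a * (a * (u \<bullet> u)) = 1" "b * (b * (u \<bullet> u)) = 1" "a * (b * (u \<bullet> u)) = 0"
      using orth[of 0 0] orth[of 1 1] orth[of 0 1] 01 unfolding ab smult by simp_all
    then show False by (metis mult_eq_0_iff zero_neq_one)
  qed
  then show pos: "kth_eigenvalue M 2 > 0"
    using nonneg[of 1] n by (simp add: es(3))
  have le: "kth_eigenvalue M 2 * es ! i \<le> (es ! i)\<^sup>2" if i: "i < n" for i
  proof (cases "i = 0")
    case False
    then have "es ! 1 \<le> es ! i" using es(1,2) i by (intro sorted_nth_mono) auto
    then show ?thesis using nonneg[OF i] by (simp add: es(3) power2_eq_square mult_right_mono)
  qed (simp add: es0)
  show "kth_eigenvalue M 2 * (x \<bullet> (M *\<^sub>v x)) \<le> (M *\<^sub>v x) \<bullet> (M *\<^sub>v x)"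
    if x: "x \<in> carrier_vec n"
    unfolding orthogonal_eigenbasis(3,4)[OF M U x] sum_distrib_left
    using le by (intro sum_mono) (auto intro!: mult_right_mono simp flip: mult.assoc)
qed

section \<open>Power sums with different exponents\<close>

lemma sum_powr_antimono_if_sum_squares_le_1:
  fixes y :: "'a \<Rightarrow> real"
  assumes "finite I" and small: "(\<Sum>i\<in>I. (y i)\<^sup>2) \<le> 1" and "p \<le> q"
  shows "(\<Sum>i\<in>I. \<bar>y i\<bar> powr q) \<le> (\<Sum>i\<in>I. \<bar>y i\<bar> powr p)"
proof (rule sum_mono)
  fix i assume i: "i \<in> I"
  have "(y i)\<^sup>2 \<le> (\<Sum>i\<in>I. (y i)\<^sup>2)"
    using i \<open>finite I\<close> by (intro member_le_sum) auto
  then have "\<bar>y i\<bar> \<le> 1" using small abs_square_le_1[of "y i"] by linarith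
  then show "\<bar>y i\<bar> powr q \<le> \<bar>y i\<bar> powr p"
    using \<open>p \<le> q\<close> by (intro powr_mono') auto
qed

text \<open>
  Young's inequality for \<open>t\<^sup>q\<close> and 1 with weights \<open>p / q\<close> and \<open>1 - p / q\<close>.
\<close>

lemma powr_le_weighted_mean:
  fixes t p q :: real
  assumes "0 \<le> t" "0 < p" "p < q"
  shows "t powr p \<le> p / q * t powr q + (1 - p / q)"
proof (cases "t = 0")
  case False
  then show ?thesis
    using Youngs_inequality_0[of "p / q" "1 - p / q" "t powr q" 1] assms by (simp add: powr_powr)
qed (use assms in simp)

text \<open>
  Summing the weighted mean bound leaves the constant \<open>1 - p / q\<close> once per index, and the hypothesis
  lets the \<open>q\<close>-th power sum absorb it.
\<close>

lemma sum_powr_mono_if_card_le_sum_powr: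
  fixes y :: "'a \<Rightarrow> real"
  assumes "0 < p" "p < q" and card: "real (card I) \<le> (\<Sum>i\<in>I. \<bar>y i\<bar> powr q)"
  shows "(\<Sum>i\<in>I. \<bar>y i\<bar> powr p) \<le> (\<Sum>i\<in>I. \<bar>y i\<bar> powr q)"
proof -
  define Q where "Q = (\<Sum>i\<in>I. \<bar>y i\<bar> powr q)"
  have "(\<Sum>i\<in>I. \<bar>y i\<bar> powr p) \<le> (\<Sum>i\<in>I. p / q * \<bar>y i\<bar> powr q + (1 - p / q))"
    using assms by (intro sum_mono powr_le_weighted_mean) auto
  also have "\<dots> = p / q * Q + (1 - p / q) * real (card I)"
    by (simp add: sum.distrib Q_def sum_distrib_left)
  also have "\<dots> \<le> p / q * Q + (1 - p / q) * Q"
    using assms card by (intro add_left_mono mult_left_mono) (auto simp: Q_def)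
  finally show ?thesis by (simp add: Q_def algebra_simps)
qed

text \<open>
  The comparison of the \<open>l\<^sup>q\<close> and the Euclidean norm: each \<open>y\<^sub>i\<^sup>2 / S\<close> lies in the unit interval,
  where passing to the exponent \<open>q / 2 \<le> 1\<close> enlarges it, and these fractions add up to 1.
\<close>

lemma sum_squares_powr_half_le_sum_powr:
  fixes y :: "'a \<Rightarrow> real"
  assumes "finite I" and q: "q \<le> 2" and pos: "0 < (\<Sum>i\<in>I. (y i)\<^sup>2)"
  shows "(\<Sum>i\<in>I. (y i)\<^sup>2) powr (q / 2) \<le> (\<Sum>i\<in>I. \<bar>y i\<bar> powr q)"
proof -
  define S where "S = (\<Sum>i\<in>I. (y i)\<^sup>2)"
  have S: "S > 0" using pos by (simp add: S_def)
  have "S powr (q / 2) * ((y i)\<^sup>2 / S) \<le> \<bar>y i\<bar> powr q" if i: "i \<in> I" for i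
  proof (cases "y i = 0")
    case False
    have "(y i)\<^sup>2 \<le> S"
      unfolding S_def using i \<open>finite I\<close> by (intro member_le_sum) auto
    then have "((y i)\<^sup>2 / S) powr 1 \<le> ((y i)\<^sup>2 / S) powr (q / 2)"
      using S q False by (intro powr_mono') auto
    then have "S powr (q / 2) * ((y i)\<^sup>2 / S) \<le> S powr (q / 2) * ((y i)\<^sup>2 / S) powr (q / 2)"
      using S by (intro mult_left_mono) auto
    also have "\<dots> = ((y i)\<^sup>2) powr (q / 2)"
      using S by (simp add: powr_divide)
    also have "\<dots> = (\<bar>y i\<bar> powr 2) powr (q / 2)"
      using False by (simp add: powr_numeral)
    also have "\<dots> = \<bar>y i\<bar> powr q"
      by (simp only: powr_powr) simp
    finally show ?thesis .
  qed simp
  then have "(\<Sum>i\<in>I. S powr (q / 2) * ((y i)\<^sup>2 / S)) \<le> (\<Sum>i\<in>I. \<bar>y i\<bar> powr q)"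
    by (rule sum_mono)
  moreover have "(\<Sum>i\<in>I. S powr (q / 2) * ((y i)\<^sup>2 / S)) = S powr (q / 2)"
    using S by (simp add: S_def flip: sum_distrib_left sum_divide_distrib)
  ultimately show ?thesis by (simp add: S_def)
qed

text \<open>
  The exponent \<open>(2 - p) / (q - p)\<close> is large enough that its multiple by \<open>q / 2\<close> is at least 1, which
  amounts to \<open>p (2 - q) \<ge> 0\<close>.  So the \<open>q\<close>-th power sum is at least the number of indices.
\<close>

lemma sum_powr_mono_if_sum_squares_large:
  fixes y :: "'a \<Rightarrow> real"
  assumes fin: "finite I" "I \<noteq> {}" and pq: "0 < p" "p < q" "q \<le> 2"
    and large: "real (card I) powr ((2 - p) / (q - p)) \<le> (\<Sum>i\<in>I. (y i)\<^sup>2)"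
  shows "(\<Sum>i\<in>I. \<bar>y i\<bar> powr p) \<le> (\<Sum>i\<in>I. \<bar>y i\<bar> powr q)"
proof (rule sum_powr_mono_if_card_le_sum_powr[OF pq(1,2)])
  let ?n = "real (card I)" and ?S = "\<Sum>i\<in>I. (y i)\<^sup>2"
  have n: "1 \<le> ?n" using fin by (simp add: Suc_le_eq card_gt_0_iff)
  then have pos: "0 < ?n powr ((2 - p) / (q - p))" by simp
  then have S: "0 < ?S" using large by linarith
  have "0 \<le> p * (2 - q)" using pq by simp
  then have "1 \<le> (2 - p) / (q - p) * (q / 2)"
    using pq by (simp add: field_simps)
  then have "?n powr 1 \<le> ?n powr ((2 - p) / (q - p) * (q / 2))"
    using n by (intro powr_mono) auto
  also have "\<dots> = (?n powr ((2 - p) / (q - p))) powr (q / 2)"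
    by (simp add: powr_powr)
  also have "\<dots> \<le> ?S powr (q / 2)"
    using large pq pos by (intro powr_mono2) auto
  also have "\<dots> \<le> (\<Sum>i\<in>I. \<bar>y i\<bar> powr q)"
    using fin pq S by (intro sum_squares_powr_half_le_sum_powr) auto
  finally show "?n \<le> (\<Sum>i\<in>I. \<bar>y i\<bar> powr q)" using n by simp
qed

section \<open>The graph Laplacian and its quadratic form\<close>

lemma laplacian_carrier: "A \<in> carrier_mat n n \<Longrightarrow> laplacian A \<in> carrier_mat n n"
  by (simp add: laplacian_def)

lemma laplacian_symmetric:
  assumes "A \<in> carrier_mat n n" "A\<^sup>T = A"
  shows "(laplacian A)\<^sup>T = laplacian A"
proof (rule eq_matI)
  fix i j assume "i < dim_row (laplacian A)" "j < dim_col (laplacian A)"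
  then have "i < dim_row A" "j < dim_row A" by (auto simp: laplacian_def)
  moreover have "A $$ (i, j) = A $$ (j, i)"
    using assms calculation by (metis carrier_matD index_transpose_mat(1))
  ultimately show "(laplacian A)\<^sup>T $$ (i, j) = laplacian A $$ (i, j)"
    by (auto simp: laplacian_def)
qed (auto simp: laplacian_def)

lemma laplacian_mult_vec:
  fixes x :: "real vec"
  assumes A: "A \<in> carrier_mat n n" and x: "x \<in> carrier_vec n" and i: "i < n"
  shows "(laplacian A *\<^sub>v x) $ i = - (\<Sum>j = 0..<n. A $$ (i, j) * (x $ j - x $ i))"
proof -
  have dim: "dim_row A = n" using A by simp
  have "(laplacian A *\<^sub>v x) $ i = (\<Sum>j = 0..<n. laplacian A $$ (i, j) * x $ j)"
    using i x dim by (simp add: laplacian_def scalar_prod_def)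
  also have "\<dots> = laplacian A $$ (i, i) * x $ i + (\<Sum>j\<in>{0..<n} - {i}. laplacian A $$ (i, j) * x $ j)"
    using i by (intro sum.remove) auto
  also have "(\<Sum>j\<in>{0..<n} - {i}. laplacian A $$ (i, j) * x $ j) = (\<Sum>j\<in>{0..<n} - {i}. - (A $$ (i, j) * x $ j))"
    using i dim by (intro sum.cong) (auto simp: laplacian_def)
  also have "laplacian A $$ (i, i) * x $ i = (\<Sum>j\<in>{0..<n} - {i}. A $$ (i, j) * x $ i)"
    using i dim by (simp add: laplacian_def sum_distrib_right)
  also have "\<dots> + (\<Sum>j\<in>{0..<n} - {i}. - (A $$ (i, j) * x $ j)) =
      (\<Sum>j\<in>{0..<n} - {i}. - (A $$ (i, j) * (x $ j - x $ i)))"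
    by (simp add: algebra_simps flip: sum.distrib)
  also have "\<dots> = (\<Sum>j = 0..<n. - (A $$ (i, j) * (x $ j - x $ i)))"
    using i by (subst (2) sum.remove[of _ i]) auto
  finally show ?thesis by (simp add: sum_negf)
qed

text \<open>
  Each edge term \<open>a\<^sub>i\<^sub>j (x\<^sub>j - x\<^sub>i)\<^sup>2\<close> splits into a part at \<open>x\<^sub>i\<close> and a part at \<open>x\<^sub>j\<close>.  Symmetry of the
  weights makes the two parts equal after exchanging the indices, and each of them sums to
  \<open>x \<bullet> L x\<close>.
\<close>

lemma V5_eq_quadratic_form:
  assumes A: "A \<in> carrier_mat n n" and sym: "A\<^sup>T = A" and x: "x \<in> carrier_vec n"
  shows "x \<bullet> (laplacian A *\<^sub>v x) = 2 * V5 A x"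
proof -
  have symA: "A $$ (i, j) = A $$ (j, i)" if "i < n" "j < n" for i j
    using A sym that by (metis carrier_matD index_transpose_mat(1))
  define T where "T = (\<Sum>i = 0..<n. \<Sum>j = 0..<n. A $$ (i, j) * (x $ i - x $ j) * x $ i)"
  have xLx: "x \<bullet> (laplacian A *\<^sub>v x) = T"
  proof -
    have "x \<bullet> (laplacian A *\<^sub>v x) = (\<Sum>i = 0..<n. x $ i * (laplacian A *\<^sub>v x) $ i)"
      using A by (simp add: scalar_prod_def laplacian_def)
    also have "\<dots> = T"
      unfolding T_def using laplacian_mult_vec[OF A x]
      by (intro sum.cong) (auto simp: sum_distrib_left algebra_simps simp flip: sum_negf sum_subtractf)
    finally show ?thesis .
  qed
  have T': "(\<Sum>i = 0..<n. \<Sum>j = 0..<n. A $$ (i, j) * (x $ j - x $ i) * x $ j) = T"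
    unfolding T_def by (subst sum.swap, intro sum.cong refl) (auto simp: symA)
  have "4 * V5 A x = (\<Sum>i = 0..<n. \<Sum>j = 0..<n. A $$ (i, j) * (x $ i - x $ j) * x $ i +
      A $$ (i, j) * (x $ j - x $ i) * x $ j)"
    using A by (simp add: V5_def power2_eq_square algebra_simps)
  also have "\<dots> = 2 * T" using T' by (simp add: sum.distrib T_def)
  finally show ?thesis using xLx by simp
qed

lemma V5_nonneg:
  assumes "A \<in> carrier_mat n n" "\<forall>i<n. \<forall>j<n. A $$ (i, j) \<ge> 0"
  shows "V5 A x \<ge> 0"
  using assms by (auto simp: V5_def intro!: sum_nonneg)

text \<open>
  An energy of 0 forces equal values at the two ends of each edge, hence along paths.
\<close>

lemma V5_zero_imp_constant:
  fixes x :: "real vec"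
  assumes A: "A \<in> carrier_mat n n" and nonneg: "\<forall>i<n. \<forall>j<n. A $$ (i, j) \<ge> 0"
    and conn: "Digraph_Component.connected (weight_graph A)"
    and V: "V5 A x = 0" and ij: "i < n" "j < n"
  shows "x $ i = x $ j"
proof -
  let ?G = "mk_symmetric (with_proj (weight_graph A))"
  have edge: "x $ k = x $ l" if "k < n" "l < n" "A $$ (k, l) > 0" for k l
  proof -
    have "A $$ (k, l) * (x $ l - x $ k)\<^sup>2 \<le> (\<Sum>j = 0..<n. A $$ (k, j) * (x $ j - x $ k)\<^sup>2)"
      using that nonneg by (intro member_le_sum[of l _ "\<lambda>j. A $$ (k, j) * (x $ j - x $ k)\<^sup>2"]) auto
    also have "\<dots> \<le> (\<Sum>i = 0..<n. \<Sum>j = 0..<n. A $$ (i, j) * (x $ j - x $ i)\<^sup>2)"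
      using that nonneg
      by (intro member_le_sum[of k _ "\<lambda>i. \<Sum>j = 0..<n. A $$ (i, j) * (x $ j - x $ i)\<^sup>2"])
        (auto intro!: sum_nonneg)
    also have "\<dots> = 0" using V A by (simp add: V5_def)
    finally have "(x $ l - x $ k)\<^sup>2 \<le> 0" using that by (simp add: mult_le_0_iff)
    then show ?thesis using that by simp
  qed
  have "(i, j) \<in> rtrancl_on (verts ?G) (arcs_ends ?G)"
    using conn ij A
    by (simp add: Digraph_Component.connected_def strongly_connected_def reachable_def
        weight_graph_def mk_symmetric_def)
  then show ?thesis
  proof (induction rule: rtrancl_on_induct)
    case (step k l)
    have "x $ k = x $ l"
      using step.hyps A
      by (auto simp: weight_graph_def mk_symmetric_def arcs_ends_def arc_to_ends_def dest: edge)
    then show ?case using step.IH by simp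
  qed simp
qed

section \<open>The decay rate of the energy\<close>

text \<open>
  Since \<open>V5\<close> is half a symmetric quadratic form, it is a quadratic polynomial in \<open>t\<close> along the line in
  direction of a unit vector, and the linear coefficient is the entry of \<open>L x\<close>.
\<close>

lemma partial_deriv_V5:
  fixes x :: "real vec"
  assumes A: "A \<in> carrier_mat n n" and sym: "A\<^sup>T = A" and x: "x \<in> carrier_vec n" and i: "i < n"
  shows "partial_deriv (V5 A) i x = (laplacian A *\<^sub>v x) $ i"
proof -
  let ?L = "laplacian A" and ?e = "unit_vec n i :: real vec"
  have L: "?L \<in> carrier_mat n n" by (rule laplacian_carrier[OF A])
  have symL: "?L\<^sup>T = ?L" by (rule laplacian_symmetric[OF A sym])
  have e: "?e \<in> carrier_vec n" by simp
  have Lx: "?L *\<^sub>v x \<in> carrier_vec n" and Le: "?L *\<^sub>v ?e \<in> carrier_vec n"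
    using L x by auto
  have eLx: "?e \<bullet> (?L *\<^sub>v x) = (?L *\<^sub>v x) $ i" using Lx i by simp
  have xLe: "x \<bullet> (?L *\<^sub>v ?e) = (?L *\<^sub>v x) $ i"
    using symmetric_mat_scalar_prod[OF L symL x e] Lx i by simp
  have "V5 A (x + t \<cdot>\<^sub>v ?e) = V5 A x + t * (?L *\<^sub>v x) $ i + t\<^sup>2 * V5 A ?e" for t
  proof -
    have te: "t \<cdot>\<^sub>v ?e \<in> carrier_vec n" by simp
    have "2 * V5 A (x + t \<cdot>\<^sub>v ?e) = (x + t \<cdot>\<^sub>v ?e) \<bullet> (?L *\<^sub>v x + t \<cdot>\<^sub>v (?L *\<^sub>v ?e))"
      using V5_eq_quadratic_form[OF A sym, of "x + t \<cdot>\<^sub>v ?e"] x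
      by (simp add: mult_add_distrib_mat_vec[OF L x te] mult_mat_vec[OF L e])
    also have "\<dots> = x \<bullet> (?L *\<^sub>v x) + t * (x \<bullet> (?L *\<^sub>v ?e))
        + (t * (?e \<bullet> (?L *\<^sub>v x)) + t * (t * (?e \<bullet> (?L *\<^sub>v ?e))))"
    proof -
      have tLe: "t \<cdot>\<^sub>v (?L *\<^sub>v ?e) \<in> carrier_vec n" using Le by simp
      have sum: "?L *\<^sub>v x + t \<cdot>\<^sub>v (?L *\<^sub>v ?e) \<in> carrier_vec n" using Lx tLe by simp
      show ?thesis
        unfolding add_scalar_prod_distrib[OF x te sum] scalar_prod_add_distrib[OF x Lx tLe]
          scalar_prod_add_distrib[OF te Lx tLe] smult_scalar_prod_distrib[OF e Lx]
          smult_scalar_prod_distrib[OF e tLe] scalar_prod_smult_distrib[OF x Le]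
          scalar_prod_smult_distrib[OF e Le] ..
    qed
    also have "\<dots> = 2 * V5 A x + 2 * t * (?L *\<^sub>v x) $ i + 2 * t\<^sup>2 * V5 A ?e"
      unfolding V5_eq_quadratic_form[OF A sym x] V5_eq_quadratic_form[OF A sym e] eLx xLe
      by (simp add: power2_eq_square)
    finally show ?thesis by simp
  qed
  moreover have "((\<lambda>t. V5 A x + t * (?L *\<^sub>v x) $ i + t\<^sup>2 * V5 A ?e)
      has_field_derivative (?L *\<^sub>v x) $ i) (at 0)"
    by (auto intro!: derivative_eq_intros)
  ultimately show ?thesis
    using x by (simp add: partial_deriv_def DERIV_imp_deriv)
qed

lemma dV5_dt_eq_neg_sum_powr:
  fixes x :: "real vec"
  assumes A: "A \<in> carrier_mat n n" and sym: "A\<^sup>T = A" and x: "x \<in> carrier_vec n"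
  shows "dV5_dt A \<alpha> x = - (\<Sum>i = 0..<n. \<bar>(laplacian A *\<^sub>v x) $ i\<bar> powr (1 + \<alpha>))"
proof -
  have sig: "z * sig (- z) \<alpha> = - (\<bar>z\<bar> powr (1 + \<alpha>))" for z :: real
    by (cases "z = 0") (auto simp: sig_def powr_add sgn_if)
  have "partial_deriv (V5 A) i x * protocol A \<alpha> x i = - (\<bar>(laplacian A *\<^sub>v x) $ i\<bar> powr (1 + \<alpha>))"
    if i: "i < n" for i
  proof -
    have "protocol A \<alpha> x i = sig (- (laplacian A *\<^sub>v x) $ i) \<alpha>"
      using A by (simp add: protocol_def laplacian_mult_vec[OF A x i])
    then show ?thesis by (simp add: partial_deriv_V5[OF A sym x i] sig)
  qed
  then show ?thesis using A by (simp add: dV5_dt_def sum_negf)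
qed

lemma laplacian_kernel_constant:
  assumes A: "A \<in> carrier_mat n n" and nonneg: "\<forall>i<n. \<forall>j<n. A $$ (i, j) \<ge> 0"
    and sym: "A\<^sup>T = A" and conn: "Digraph_Component.connected (weight_graph A)"
    and v: "v \<in> carrier_vec n" and Lv: "laplacian A *\<^sub>v v = 0\<^sub>v n"
  shows "\<exists>c. v = c \<cdot>\<^sub>v vec n (\<lambda>_. 1)"
proof (intro exI eq_vecI)
  have "V5 A v = 0" using V5_eq_quadratic_form[OF A sym v] v by (simp add: Lv)
  then show "v $ i = (v $ 0 \<cdot>\<^sub>v vec n (\<lambda>_. 1)) $ i" if "i < dim_vec (v $ 0 \<cdot>\<^sub>v vec n (\<lambda>_. 1))" for i
    using V5_zero_imp_constant[OF A nonneg conn, of v i 0] that by simp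
qed (use v in simp)

section \<open>Comparison of the two exponents\<close>

theorem theorem5:
  fixes n :: nat and A :: "real mat" and \<alpha>\<^sub>1 \<alpha>\<^sub>2 :: real and x :: "real vec"
  assumes "n \<ge> 2"
    and "A \<in> carrier_mat n n"
    and "\<And>i j. i < n \<Longrightarrow> j < n \<Longrightarrow> A $$ (i, j) \<ge> 0"
    and "A\<^sup>T = A"
    and "\<And>i. i < n \<Longrightarrow> A $$ (i, i) = 0"
    and "Digraph_Component.connected (weight_graph A)"
    and "0 < \<alpha>\<^sub>1" and "\<alpha>\<^sub>1 < \<alpha>\<^sub>2" and "\<alpha>\<^sub>2 < 1"
    and "x \<in> carrier_vec n"
  shows "(V5 A x \<ge> 1 / (2 * kth_eigenvalue (laplacian A) 2)
                     * real n powr ((1 - \<alpha>\<^sub>1) / (\<alpha>\<^sub>2 - \<alpha>\<^sub>1))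
            \<longrightarrow> dV5_dt A \<alpha>\<^sub>2 x \<le> dV5_dt A \<alpha>\<^sub>1 x)
       \<and> (V5 A x \<le> 1 / (2 * kth_eigenvalue (laplacian A) n)
            \<longrightarrow> dV5_dt A \<alpha>\<^sub>1 x \<le> dV5_dt A \<alpha>\<^sub>2 x)"
proof -
  note n = assms(1) and A = assms(2) and sym = assms(4) and conn = assms(6)
    and \<alpha> = assms(7-9) and x = assms(10)
  have nonneg: "\<forall>i<n. \<forall>j<n. A $$ (i, j) \<ge> 0" using assms(3) by blast
  let ?L = "laplacian A"
  define y where "y i = (?L *\<^sub>v x) $ i" for i
  define S where "S = (\<Sum>i = 0..<n. (y i)\<^sup>2)"
  define lam where "lam k = kth_eigenvalue ?L k" for k
  have L: "?L \<in> carrier_mat n n" by (rule laplacian_carrier[OF A])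
  have symL: "?L\<^sup>T = ?L" by (rule laplacian_symmetric[OF A sym])
  have psd: "\<forall>v\<in>carrier_vec n. 0 \<le> v \<bullet> (?L *\<^sub>v v)"
    using V5_eq_quadratic_form[OF A sym] V5_nonneg[OF A nonneg] by simp
  let ?one = "vec n (\<lambda>_. 1) :: real vec"
  have "?one $ 0 \<noteq> 0\<^sub>v n $ 0" using n by simp
  then have one: "?one \<noteq> 0\<^sub>v n" by metis
  have Lone: "?L *\<^sub>v ?one = 0\<^sub>v n"
  proof (rule eq_vecI)
    fix i assume "i < dim_vec (0\<^sub>v n :: real vec)"
    then show "(?L *\<^sub>v ?one) $ i = 0\<^sub>v n $ i" by (simp add: laplacian_mult_vec[OF A])
  qed (use L in simp)
  have S: "S = (?L *\<^sub>v x) \<bullet> (?L *\<^sub>v x)"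
    using L by (simp add: S_def y_def scalar_prod_def power2_eq_square)
  have ker: "\<forall>v\<in>carrier_vec n. ?L *\<^sub>v v = 0\<^sub>v n \<longrightarrow> (\<exists>c. v = c \<cdot>\<^sub>v ?one)"
    using laplacian_kernel_constant[OF A nonneg sym conn] by blast
  note gap = psd_simple_kernel_second_eigenvalue[OF n L symL psd vec_carrier one Lone ker]
  have pos: "lam 2 > 0"
    unfolding lam_def by (rule gap(1))
  have second: "lam 2 * (2 * V5 A x) \<le> S"
    using gap(2)[OF x] by (simp add: lam_def S V5_eq_quadratic_form[OF A sym x])
  have largest: "S \<le> lam n * (2 * V5 A x)"
    using psd_norm_le_largest_eigenvalue[OF L symL psd x]
    by (simp add: lam_def S V5_eq_quadratic_form[OF A sym x])
  have dV: "dV5_dt A \<alpha> x = - (\<Sum>i = 0..<n. \<bar>y i\<bar> powr (1 + \<alpha>))" for \<alpha>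
    by (simp add: dV5_dt_eq_neg_sum_powr[OF A sym x] y_def)
  show ?thesis
  proof (intro conjI impI)
    assume "V5 A x \<ge> 1 / (2 * kth_eigenvalue ?L 2) * real n powr ((1 - \<alpha>\<^sub>1) / (\<alpha>\<^sub>2 - \<alpha>\<^sub>1))"
    then have "real n powr ((1 - \<alpha>\<^sub>1) / (\<alpha>\<^sub>2 - \<alpha>\<^sub>1)) \<le> lam 2 * (2 * V5 A x)"
      using pos by (simp add: lam_def field_simps)
    then have "real n powr ((1 - \<alpha>\<^sub>1) / (\<alpha>\<^sub>2 - \<alpha>\<^sub>1)) \<le> S"
      using second by simp
    then have "(\<Sum>i = 0..<n. \<bar>y i\<bar> powr (1 + \<alpha>\<^sub>1)) \<le> (\<Sum>i = 0..<n. \<bar>y i\<bar> powr (1 + \<alpha>\<^sub>2))"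
      using n \<alpha> by (intro sum_powr_mono_if_sum_squares_large) (auto simp: S_def)
    then show "dV5_dt A \<alpha>\<^sub>2 x \<le> dV5_dt A \<alpha>\<^sub>1 x" by (simp add: dV)
  next
    assume small: "V5 A x \<le> 1 / (2 * kth_eigenvalue ?L n)"
    \<comment> \<open>If \<open>lam n \<le> 0\<close>, the threshold carries no information, but then the spectral bound alone gives \<open>S \<le> 0\<close>.\<close>
    have "S \<le> 1"
    proof (cases "lam n > 0")
      case True
      then have "lam n * (2 * V5 A x) \<le> 1" using small by (simp add: lam_def field_simps)
      then show ?thesis using largest by simp
    next
      case False
      then have "lam n * (2 * V5 A x) \<le> 0"
        using V5_nonneg[OF A nonneg, of x] by (intro mult_nonpos_nonneg) auto
      then show ?thesis using largest by simp
    qed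
    then show "dV5_dt A \<alpha>\<^sub>1 x \<le> dV5_dt A \<alpha>\<^sub>2 x"
      using \<alpha> by (auto simp: dV S_def intro!: sum_powr_antimono_if_sum_squares_le_1)
  qed
qed

end
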